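(* Let $G$ be an $s$–$t$ graph, let $n,k\ge1$, and let $u:(P_{st})^n\times E^k\to\mathbb{R}$ be a payoff function such that $$\max_{\sigma\in(\Delta(P_{st}))^n}\min_{d\in E^k}u(\sigma,d)>0.$$ Then there is a cost function $C:(P_{st})^n\times E^k\to\mathbb{R}$ such that $r(G,n,k,C)=\tilde r(G,n,k,u)$.
   Context: Graph: $G=(V,E,s,t)$ is a finite directed acyclic multigraph ($E$ is a multiset) with source $s$ and sink $t\neq s$, such that $E\ne\emptyset$ and every edge lies on some directed $s$–$t$ path. $P_{st}$ is the set of directed $s$–$t$ paths. Pure strategies of the $n$ agents form $(P_{st})^n$, those of the $k$ interceptors form $E^k$. $\Delta X$ is the set of probability distributions on $X$; elements of $(\Delta(P_{st}))^n$ are identified with product distributions on $(P_{st})^n$. Functions on pure strategies are extended to mixed strategies by expectation: $u(\sigma,d)=\mathbb{E}_{a\sim\sigma}[u(a,d)]$, and similarly for $C$. Price of uncorrelation for a cost function $C$ (agents minimize): $$r(G,n,k,C)=\frac{\min_{\sigma\in(\Delta(P_{st}))^n}\max_{d\in E^k}C(\sigma,d)}{\min_{\sigma\in\Delta((P_{st})^n)}\max_{d\in E^k}C(\sigma,d)}.$$ Price of uncorrelation for a payoff function $u$ (agents maximize): $$\tilde r(G,n,k,u)=\frac{\max_{\sigma\in\Delta((P_{st})^n)}\min_{d\in E^k}u(\sigma,d)}{\max_{\sigma\in(\Delta(P_{st}))^n}\min_{d\in E^k}u(\sigma,d)}.$$ *)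

theory Defs
  imports "HOL-Probability.Probability" "Graph_Theory.Arc_Walk"
begin

text \<open>
  Arcs of a \<^typ>\<open>('v, 'e) pre_digraph\<close> have an identity of their own, so parallel arcs are
  allowed, and paths that differ only by using parallel arcs are different paths.
\<close>

definition st_paths :: "('v, 'e) pre_digraph \<Rightarrow> 'v \<Rightarrow> 'v \<Rightarrow> 'e list set" where
  "st_paths G s t = {p. pre_digraph.apath G s p t}"

locale st_graph = fin_digraph G
  for G :: "('v, 'e) pre_digraph" (structure) +
  fixes s t :: 'v
  assumes source_in_verts: "s \<in> verts G"
    and sink_in_verts: "t \<in> verts G"
    and source_neq_sink: "s \<noteq> t"
    and acyclic: "\<nexists>c. cycle c"
    and arcs_nonempty: "arcs G \<noteq> {}"
    and arc_on_st_path: "e \<in> arcs G \<Longrightarrow> \<exists>p \<in> st_paths G s t. e \<in> set p"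

text \<open>
  A tuple of length \<open>m\<close> is a function on \<open>{..<m}\<close>, extended by \<^const>\<open>undefined\<close>.
\<close>

definition agent_strategies ::
    "('v, 'e) pre_digraph \<Rightarrow> 'v \<Rightarrow> 'v \<Rightarrow> nat \<Rightarrow> (nat \<Rightarrow> 'e list) set" where
  "agent_strategies G s t n = {..<n} \<rightarrow>\<^sub>E st_paths G s t"

definition interceptor_strategies :: "('v, 'e) pre_digraph \<Rightarrow> nat \<Rightarrow> (nat \<Rightarrow> 'e) set" where
  "interceptor_strategies G k = {..<k} \<rightarrow>\<^sub>E arcs G"

definition distributions :: "'a set \<Rightarrow> 'a pmf set" where
  "distributions X = {\<sigma>. set_pmf \<sigma> \<subseteq> X}"

definition correlated_strategies ::
    "('v, 'e) pre_digraph \<Rightarrow> 'v \<Rightarrow> 'v \<Rightarrow> nat \<Rightarrow> (nat \<Rightarrow> 'e list) pmf set" where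
  "correlated_strategies G s t n = distributions (agent_strategies G s t n)"

text \<open>
  The default value \<^const>\<open>undefined\<close> of the product distribution matches the extension of tuples,
  so that these are distributions on \<^const>\<open>agent_strategies\<close>.
\<close>

definition uncorrelated_strategies ::
    "('v, 'e) pre_digraph \<Rightarrow> 'v \<Rightarrow> 'v \<Rightarrow> nat \<Rightarrow> (nat \<Rightarrow> 'e list) pmf set" where
  "uncorrelated_strategies G s t n =
     {Pi_pmf {..<n} undefined q | q. \<forall>i<n. q i \<in> distributions (st_paths G s t)}"

text \<open>
  Cost and payoff functions are total functions on the types of the tuples; only their values on
  \<^const>\<open>agent_strategies\<close> and \<^const>\<open>interceptor_strategies\<close> enter below.
\<close>

definition expected :: "('a \<Rightarrow> 'd \<Rightarrow> real) \<Rightarrow> 'a pmf \<Rightarrow> 'd \<Rightarrow> real" where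
  "expected f \<sigma> d = measure_pmf.expectation \<sigma> (\<lambda>a. f a d)"

text \<open>
  The sets of mixed strategies are infinite in general, where \<^const>\<open>Min\<close> and \<^const>\<open>Max\<close> do not
  apply; \<^const>\<open>Least\<close> and \<^const>\<open>Greatest\<close> give the minimum and maximum of the set of values, which
  are attained by compactness. The strategies of the interceptors form a finite set.
\<close>

definition min_max_cost ::
    "('v, 'e) pre_digraph \<Rightarrow> nat \<Rightarrow> ('a \<Rightarrow> (nat \<Rightarrow> 'e) \<Rightarrow> real) \<Rightarrow> 'a pmf set \<Rightarrow> real" where
  "min_max_cost G k C \<Sigma> =
     (LEAST v. v \<in> (\<lambda>\<sigma>. MAX d \<in> interceptor_strategies G k. expected C \<sigma> d) ` \<Sigma>)"

definition max_min_payoff ::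
    "('v, 'e) pre_digraph \<Rightarrow> nat \<Rightarrow> ('a \<Rightarrow> (nat \<Rightarrow> 'e) \<Rightarrow> real) \<Rightarrow> 'a pmf set \<Rightarrow> real" where
  "max_min_payoff G k u \<Sigma> =
     (GREATEST v. v \<in> (\<lambda>\<sigma>. MIN d \<in> interceptor_strategies G k. expected u \<sigma> d) ` \<Sigma>)"

definition cost_price_of_uncorrelation ::
    "('v, 'e) pre_digraph \<Rightarrow> 'v \<Rightarrow> 'v \<Rightarrow> nat \<Rightarrow> nat \<Rightarrow>
      ((nat \<Rightarrow> 'e list) \<Rightarrow> (nat \<Rightarrow> 'e) \<Rightarrow> real) \<Rightarrow> real" where
  "cost_price_of_uncorrelation G s t n k C =
     min_max_cost G k C (uncorrelated_strategies G s t n) /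
     min_max_cost G k C (correlated_strategies G s t n)"

definition payoff_price_of_uncorrelation ::
    "('v, 'e) pre_digraph \<Rightarrow> 'v \<Rightarrow> 'v \<Rightarrow> nat \<Rightarrow> nat \<Rightarrow>
      ((nat \<Rightarrow> 'e list) \<Rightarrow> (nat \<Rightarrow> 'e) \<Rightarrow> real) \<Rightarrow> real" where
  "payoff_price_of_uncorrelation G s t n k u =
     max_min_payoff G k u (correlated_strategies G s t n) /
     max_min_payoff G k u (uncorrelated_strategies G s t n)"

end

(* Let A > 0 and B be the optimal payoffs over uncorrelated and correlated strategies. The cost
   C = A + B - u has optimal costs (A + B) - A = B and (A + B) - B = A, so its price of
   uncorrelation is B / A. That this reversal is legitimate depends on the optima being attained:
   the mass functions of either kind of strategy form a compact set, on which the guaranteed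
   payoff is continuous. *)

theory Submission
  imports Defs
begin

section \<open>Compactness of sets of mixed strategies\<close>

text \<open>Compactness is argued in the function space \<open>'a \<Rightarrow> real\<close> with
  its product topology, so mixed strategies are represented by their mass functions. The description
  is a box cut by a hyperplane; coordinates off \<open>X\<close> are pinned to 0, so every factor of
  the box is compact even when the type is infinite.\<close>

lemma pmf_image_distributions:
  assumes "finite X"
  shows "pmf ` distributions X =
    {f. (\<forall>x. f x \<in> (if x \<in> X then {0..1} else {0})) \<and> sum f X = 1}"
proof (intro equalityI subsetI)
  fix f assume "f \<in> pmf ` distributions X"
  then obtain p where p: "f = pmf p" "set_pmf p \<subseteq> X"
    by (auto simp: distributions_def)
  then show "f \<in> {f. (\<forall>x. f x \<in> (if x \<in> X then {0..1} else {0})) \<and> sum f X = 1}"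
    using assms by (auto simp: pmf_le_1 sum_pmf_eq_1 pmf_eq_0_set_pmf)
next
  fix f :: "'a \<Rightarrow> real"
  assume "f \<in> {f. (\<forall>x. f x \<in> (if x \<in> X then {0..1} else {0})) \<and> sum f X = 1}"
  then have f: "\<And>x. f x \<in> (if x \<in> X then {0..1} else {0})" and sum: "sum f X = 1"
    by auto
  have nonneg: "f x \<ge> 0" for x
    using f[of x] by (auto split: if_splits)
  have supp: "{x. f x \<noteq> 0} \<subseteq> X"
  proof
    fix x assume "x \<in> {x. f x \<noteq> 0}"
    then show "x \<in> X" using f[of x] by (auto split: if_splits)
  qed
  have "(\<integral>\<^sup>+x. ennreal (f x) \<partial>count_space UNIV) = (\<Sum>x\<in>X. ennreal (f x))"
    using supp assms by (intro nn_integral_count_space') force+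
  also have "\<dots> = 1"
    using nonneg sum by (simp add: sum_ennreal)
  finally have prob: "(\<integral>\<^sup>+x. ennreal (f x) \<partial>count_space UNIV) = 1" .
  have "f = pmf (embed_pmf f)"
    using pmf_embed_pmf[OF nonneg prob] by auto
  moreover have "set_pmf (embed_pmf f) \<subseteq> X"
    using set_embed_pmf[OF nonneg prob] supp by auto
  ultimately show "f \<in> pmf ` distributions X"
    by (auto simp: distributions_def)
qed

text \<open>Tychonoff's theorem, transferred from the abstract product topology to the topology of
  the function type.\<close>

lemma compact_Pi_UNIV:
  fixes S :: "'a \<Rightarrow> 'b::topological_space set"
  assumes "\<And>i. compact (S i)"
  shows "compact {f. \<forall>i. f i \<in> S i}"
proof -
  have "compactin (product_topology (\<lambda>_. euclidean) UNIV) (PiE UNIV S)"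
    using assms by (simp add: compactin_PiE)
  moreover have "PiE UNIV S = {f. \<forall>i. f i \<in> S i}"
    by auto
  ultimately show ?thesis
    by (simp add: euclidean_product_topology)
qed

lemma compact_pmf_distributions:
  assumes "finite X"
  shows "compact (pmf ` distributions X)"
proof -
  have "compact {f. \<forall>x. f x \<in> (if x \<in> X then {0..1} else {0::real})}"
    by (rule compact_Pi_UNIV) auto
  moreover have "closed {f :: 'a \<Rightarrow> real. sum f X = 1}"
    by (intro closed_Collect_eq continuous_intros continuous_on_product_coordinates)
  ultimately show ?thesis
    unfolding pmf_image_distributions[OF assms] Collect_conj_eq by (rule compact_Int_closed)
qed

text \<open>Product distributions form the image of a product of compact simplices under a
  continuous map, multiplication of the factors' mass functions.\<close>

lemma compact_pmf_Pi_pmf: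
  assumes "finite I" and "\<And>i. i \<in> I \<Longrightarrow> finite (P i)"
  shows "compact (pmf ` {Pi_pmf I dflt q | q. \<forall>i\<in>I. q i \<in> distributions (P i)})"
    (is "compact (pmf ` ?\<Sigma>)")
proof -
  \<comment> \<open>Indices outside \<open>I\<close> do not affect the product distribution; a
    singleton there keeps the product over all indices compact.\<close>
  define S where "S i = (if i \<in> I then pmf ` distributions (P i) else {\<lambda>_. 0})" for i
  \<comment> \<open>\<open>T\<close> is the formula \<open>pmf_Pi\<close> for the mass function of
    \<open>Pi_pmf\<close>, read as a function of the factors' mass functions.\<close>
  define T where
    "T g a = (if \<forall>i. i \<notin> I \<longrightarrow> a i = dflt then \<Prod>i\<in>I. g i (a i) else 0)"
    for g :: "'a \<Rightarrow> 'b \<Rightarrow> real" and a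
  have "compact {g. \<forall>i. g i \<in> S i}"
    by (rule compact_Pi_UNIV) (auto simp: S_def assms compact_pmf_distributions)
  moreover have "continuous_on {g. \<forall>i. g i \<in> S i} T"
  proof (rule continuous_on_coordinatewise_then_product)
    fix a
    have "continuous_on {g. \<forall>i. g i \<in> S i} (\<lambda>g. g i (a i))" for i
    proof -
      have "continuous_on {g. \<forall>i. g i \<in> S i} (\<lambda>g. g i)"
        by (rule continuous_on_subset[OF continuous_on_product_coordinates]) simp
      then show ?thesis
        by (rule continuous_on_product_then_coordinatewise)
    qed
    \<comment> \<open>The condition in \<open>T\<close> depends on \<open>a\<close> only, not on
      \<open>g\<close>. Replacing it by a fixed truth value \<open>b\<close> leaves either a finite
      product of coordinates or a constant.\<close>
    then have "continuous_on {g. \<forall>i. g i \<in> S i}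
        (\<lambda>g. if b then \<Prod>i\<in>I. g i (a i) else 0)" for b
      by (cases b) (simp_all add: continuous_on_prod)
    then show "continuous_on {g. \<forall>i. g i \<in> S i} (\<lambda>g. T g a)"
      unfolding T_def .
  qed
  ultimately have "compact (T ` {g. \<forall>i. g i \<in> S i})"
    by (rule compact_continuous_image[rotated])
  moreover have "pmf ` ?\<Sigma> = T ` {g. \<forall>i. g i \<in> S i}"
  proof (intro equalityI subsetI)
    fix f assume "f \<in> pmf ` ?\<Sigma>"
    then obtain q where q: "f = pmf (Pi_pmf I dflt q)" "\<forall>i\<in>I. q i \<in> distributions (P i)"
      by auto
    define g where "g = (\<lambda>i. if i \<in> I then pmf (q i) else (\<lambda>_. 0))"
    have "f = T g"
      using assms(1) by (auto simp: q(1) T_def g_def pmf_Pi fun_eq_iff)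
    moreover have "\<forall>i. g i \<in> S i"
      using q(2) by (auto simp: g_def S_def)
    ultimately show "f \<in> T ` {g. \<forall>i. g i \<in> S i}"
      by auto
  next
    fix f assume "f \<in> T ` {g. \<forall>i. g i \<in> S i}"
    then obtain g where f: "f = T g" and g: "\<forall>i. g i \<in> S i"
      by auto
    have "\<forall>i\<in>I. \<exists>p. p \<in> distributions (P i) \<and> g i = pmf p"
      using g by (auto simp: S_def split: if_splits)
    then obtain q where q: "\<forall>i\<in>I. q i \<in> distributions (P i) \<and> g i = pmf (q i)"
      by metis
    then have "f = pmf (Pi_pmf I dflt q)"
      using assms(1) by (auto simp: f T_def pmf_Pi fun_eq_iff)
    with q show "f \<in> pmf ` ?\<Sigma>"
      by auto
  qed
  ultimately show ?thesis
    by simp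
qed

section \<open>Attainment of optima and reversal of payoffs\<close>

text \<open>For a fixed \<open>d\<close> this makes the expectation a finite linear combination of
  the coordinates of \<open>pmf \<sigma>\<close>, hence continuous in the mass function.\<close>

lemma expected_eq_sum:
  assumes "finite X" and "\<sigma> \<in> distributions X"
  shows "expected f \<sigma> d = (\<Sum>a\<in>X. pmf \<sigma> a * f a d)"
  using assms unfolding expected_def distributions_def
  by (subst integral_measure_pmf[of X]) auto

lemma expected_const_minus:
  assumes "finite X" and "\<sigma> \<in> distributions X"
  shows "expected (\<lambda>a d. c - f a d) \<sigma> d = c - expected f \<sigma> d"
proof -
  have "(\<Sum>a\<in>X. pmf \<sigma> a) = 1"
    using assms by (auto simp: distributions_def sum_pmf_eq_1)
  then show ?thesis
    by (simp add: expected_eq_sum[OF assms] right_diff_distrib sum_subtractf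
        flip: sum_distrib_right)
qed

lemma continuous_on_MIN:
  fixes f :: "'d \<Rightarrow> 'a::topological_space \<Rightarrow> 'b::linorder_topology"
  assumes "finite D" "D \<noteq> {}" "\<And>d. d \<in> D \<Longrightarrow> continuous_on A (f d)"
  shows "continuous_on A (\<lambda>x. MIN d\<in>D. f d x)"
  using assms
  by (induction D rule: finite_ne_induct) (auto intro!: continuous_on_min)

lemma MAX_const_minus:
  fixes f :: "'d \<Rightarrow> real"
  assumes "finite D" "D \<noteq> {}"
  shows "(MAX d\<in>D. c - f d) = c - (MIN d\<in>D. f d)"
proof (rule Max_eqI)
  have "(MIN d\<in>D. f d) \<in> f ` D"
    using assms by (intro Min_in) auto
  then show "c - (MIN d\<in>D. f d) \<in> (\<lambda>d. c - f d) ` D"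
    by auto
qed (use assms in auto)

text \<open>The extreme value theorem, applied to the guaranteed payoff on the compact set of mass
  functions.\<close>

lemma max_min_payoff_attained:
  fixes u :: "'a \<Rightarrow> 'd \<Rightarrow> real"
  assumes "finite X" "\<Sigma> \<subseteq> distributions X" "\<Sigma> \<noteq> {}" "compact (pmf ` \<Sigma>)"
    and "finite D" "D \<noteq> {}"
  obtains \<sigma> where "\<sigma> \<in> \<Sigma>"
    and "\<And>\<tau>. \<tau> \<in> \<Sigma> \<Longrightarrow> (MIN d\<in>D. expected u \<tau> d) \<le> (MIN d\<in>D. expected u \<sigma> d)"
proof -
  \<comment> \<open>\<open>V\<close> takes arbitrary real functions, where the topology is
    available; on mass functions of strategies in \<open>\<Sigma>\<close> it is the guaranteed
    payoff.\<close>
  define V where "V f = (MIN d\<in>D. \<Sum>a\<in>X. f a * u a d)" for f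
  have V: "V (pmf \<sigma>) = (MIN d\<in>D. expected u \<sigma> d)" if "\<sigma> \<in> \<Sigma>" for \<sigma>
    using that assms(1,2) by (simp add: V_def expected_eq_sum[of X] subset_eq)
  have "continuous_on (pmf ` \<Sigma>) V"
    unfolding V_def using assms(5,6)
    by (intro continuous_on_MIN continuous_intros continuous_on_product_then_coordinatewise
        continuous_on_id) auto
  then obtain \<sigma> where "\<sigma> \<in> \<Sigma>" "\<forall>\<tau>\<in>\<Sigma>. V (pmf \<tau>) \<le> V (pmf \<sigma>)"
    using continuous_attains_sup[of "pmf ` \<Sigma>" V] assms(3,4) by auto
  then show thesis
    using V that by auto
qed

text \<open>Since \<open>v \<mapsto> c - v\<close> reverses the order, a maximizer of the guaranteed
  payoff minimizes the worst-case cost. Such a maximizer is what gives \<open>LEAST\<close> and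
  \<open>GREATEST\<close> their intended values.\<close>

lemma min_max_cost_const_minus:
  fixes u :: "'a \<Rightarrow> (nat \<Rightarrow> 'e) \<Rightarrow> real"
  assumes "finite X" "\<Sigma> \<subseteq> distributions X" "\<Sigma> \<noteq> {}" "compact (pmf ` \<Sigma>)"
    and D: "finite (interceptor_strategies G k)" "interceptor_strategies G k \<noteq> {}"
  shows "min_max_cost G k (\<lambda>a d. c - u a d) \<Sigma> = c - max_min_payoff G k u \<Sigma>"
proof -
  define V where "V \<sigma> = (MIN d\<in>interceptor_strategies G k. expected u \<sigma> d)" for \<sigma>
  obtain \<sigma> where \<sigma>: "\<sigma> \<in> \<Sigma>" "\<And>\<tau>. \<tau> \<in> \<Sigma> \<Longrightarrow> V \<tau> \<le> V \<sigma>"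
    using max_min_payoff_attained[OF assms] unfolding V_def by metis
  have "(MAX d\<in>interceptor_strategies G k. expected (\<lambda>a d. c - u a d) \<tau> d) = c - V \<tau>"
    if "\<tau> \<in> \<Sigma>" for \<tau>
    using that assms(1,2) D
    by (simp add: V_def MAX_const_minus expected_const_minus[of X] subset_eq)
  then have "min_max_cost G k (\<lambda>a d. c - u a d) \<Sigma> = (LEAST v. v \<in> (\<lambda>\<tau>. c - V \<tau>) ` \<Sigma>)"
    by (simp add: min_max_cost_def cong: image_cong)
  also have "\<dots> = c - V \<sigma>"
    using \<sigma> by (intro Least_equality) auto
  also have "V \<sigma> = max_min_payoff G k u \<Sigma>"
    unfolding max_min_payoff_def V_def[symmetric] using \<sigma>
    by (intro Greatest_equality[symmetric]) auto
  finally show ?thesis .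
qed

section \<open>Strategies on an s-t graph\<close>

text \<open>This lets both kinds of strategies be treated as distributions on the same finite set
  \<open>agent_strategies G s t n\<close>.\<close>

lemma uncorrelated_subset_correlated:
  "uncorrelated_strategies G s t n \<subseteq> correlated_strategies G s t n"
proof
  fix \<sigma> assume "\<sigma> \<in> uncorrelated_strategies G s t n"
  then obtain q where "\<sigma> = Pi_pmf {..<n} undefined q"
    and "\<forall>i<n. set_pmf (q i) \<subseteq> st_paths G s t"
    by (auto simp: uncorrelated_strategies_def distributions_def)
  then show "\<sigma> \<in> correlated_strategies G s t n"
    by (fastforce simp: correlated_strategies_def distributions_def agent_strategies_def
        set_Pi_pmf PiE_dflt_def)
qed

context st_graph
begin

lemma finite_st_paths: "finite (st_paths G s t)"
  unfolding st_paths_def by (rule apaths_finite)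

lemma finite_agent_strategies: "finite (agent_strategies G s t n)"
  unfolding agent_strategies_def by (intro finite_PiE finite_st_paths) auto

lemma finite_interceptor_strategies: "finite (interceptor_strategies G k)"
  unfolding interceptor_strategies_def by (intro finite_PiE) auto

lemma interceptor_strategies_nonempty: "interceptor_strategies G k \<noteq> {}"
  unfolding interceptor_strategies_def using arcs_nonempty by (simp add: PiE_eq_empty_iff)

lemma uncorrelated_strategies_nonempty: "uncorrelated_strategies G s t n \<noteq> {}"
proof -
  \<comment> \<open>Some arc exists, and it lies on a path from \<open>s\<close> to
    \<open>t\<close>; all agents then play this path with certainty.\<close>
  obtain p where "p \<in> st_paths G s t"
    using arcs_nonempty arc_on_st_path by blast
  then have "Pi_pmf {..<n} undefined (\<lambda>_. return_pmf p) \<in> uncorrelated_strategies G s t n"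
    unfolding uncorrelated_strategies_def distributions_def by fastforce
  then show ?thesis
    by auto
qed

lemma compact_pmf_uncorrelated_strategies: "compact (pmf ` uncorrelated_strategies G s t n)"
  using compact_pmf_Pi_pmf[of "{..<n}" "\<lambda>_. st_paths G s t" undefined] finite_st_paths
  by (simp add: uncorrelated_strategies_def Ball_def)

lemma compact_pmf_correlated_strategies: "compact (pmf ` correlated_strategies G s t n)"
  unfolding correlated_strategies_def
  by (intro compact_pmf_distributions finite_agent_strategies)

end

theorem lemma20:
  fixes G :: "('v, 'e) pre_digraph" and s t :: 'v and n k :: nat
    and u :: "(nat \<Rightarrow> 'e list) \<Rightarrow> (nat \<Rightarrow> 'e) \<Rightarrow> real"
  assumes "st_graph G s t"
    and "n \<ge> 1" and "k \<ge> 1"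
    and "max_min_payoff G k u (uncorrelated_strategies G s t n) > 0"
  shows "\<exists>C :: (nat \<Rightarrow> 'e list) \<Rightarrow> (nat \<Rightarrow> 'e) \<Rightarrow> real.
           cost_price_of_uncorrelation G s t n k C = payoff_price_of_uncorrelation G s t n k u"
proof -
  interpret st_graph G s t by fact
  define A where "A = max_min_payoff G k u (uncorrelated_strategies G s t n)"
  define B where "B = max_min_payoff G k u (correlated_strategies G s t n)"
  let ?C = "\<lambda>a d. A + B - u a d"
  have reversal: "min_max_cost G k ?C \<Sigma> = A + B - max_min_payoff G k u \<Sigma>"
    if "\<Sigma> \<subseteq> correlated_strategies G s t n" "\<Sigma> \<noteq> {}" "compact (pmf ` \<Sigma>)" for \<Sigma>
    using that finite_agent_strategies finite_interceptor_strategies interceptor_strategies_nonempty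
    unfolding correlated_strategies_def by (intro min_max_cost_const_minus)
  have "min_max_cost G k ?C (uncorrelated_strategies G s t n) = B"
    using reversal[OF uncorrelated_subset_correlated uncorrelated_strategies_nonempty
        compact_pmf_uncorrelated_strategies]
    by (simp add: A_def)
  moreover have "min_max_cost G k ?C (correlated_strategies G s t n) = A"
    \<comment> \<open>Correlated strategies exist because uncorrelated ones do.\<close>
    using reversal[OF subset_refl _ compact_pmf_correlated_strategies]
      uncorrelated_subset_correlated[of G s t n] uncorrelated_strategies_nonempty[of n]
    by (auto simp: B_def)
  ultimately have "cost_price_of_uncorrelation G s t n k ?C =
      payoff_price_of_uncorrelation G s t n k u"
    by (simp add: cost_price_of_uncorrelation_def payoff_price_of_uncorrelation_def A_def B_def)
  then show ?thesis
    by blast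
qed

end
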